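(* Let $n\ge 1$ and let $\Omega=\bigcup_{j=1}^n[a_j,a_j+r_j)\subset\mathbb{R}$ with $r_j>0$, $\sum_{j=1}^n r_j=1$ and $a_j+r_j<a_{j+1}$ for $1\le j<n$. Let $\Lambda$ be a spectrum for $\Omega$ with $0\in\Lambda$, such that $\Gamma=\Lambda-\Lambda=\{\lambda-\lambda':\lambda,\lambda'\in\Lambda\}$ is $\delta$-separated for some $\delta>0$. Then $\Lambda$ contains a complete arithmetic progression, i.e. there are $a\in\mathbb{R}$ and $d>0$ with $a+d\mathbb{Z}\subseteq\Lambda$. Further, $\Lambda$ is contained in a lattice with a base.
   Context: A set $\Lambda\subset\mathbb{R}$ is a spectrum for a measurable set $\Omega\subset\mathbb{R}$ of finite positive measure if the functions $e_\lambda(x)=|\Omega|^{-1/2}e^{2\pi i\lambda x}\chi_\Omega(x)$, $\lambda\in\Lambda$, form an orthonormal basis of $L^2(\Omega)$. A discrete set $\Delta\subset\mathbb{R}$ is $\delta$-separated if $\inf\{|\lambda-\lambda'|:\lambda,\lambda'\in\Delta,\ \lambda\ne\lambda'\}=\delta>0$. A "lattice with a base" is a set of the form $\{0,b_1,\dots,b_l\}+M\mathbb{Z}$ with $M>0$ and finitely many real numbers $b_1,\dots,b_l$. *)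

theory Defs
  imports "HOL-Analysis.Analysis"
begin

text \<open>
  Square-integrable functions are handled through representatives: elements are genuine functions,
  and two functions that agree almost everywhere have the same inner products and norms.
\<close>

definition square_integrable :: "'a measure \<Rightarrow> ('a \<Rightarrow> complex) set" where
  "square_integrable M =
     {f \<in> borel_measurable M. integrable M (\<lambda>x. (cmod (f x))\<^sup>2)}"

definition L2_inner :: "'a measure \<Rightarrow> ('a \<Rightarrow> complex) \<Rightarrow> ('a \<Rightarrow> complex) \<Rightarrow> complex" where
  "L2_inner M f g = (LINT x|M. f x * cnj (g x))"

definition L2_norm :: "'a measure \<Rightarrow> ('a \<Rightarrow> complex) \<Rightarrow> real" where
  "L2_norm M f = sqrt (LINT x|M. (cmod (f x))\<^sup>2)"

text \<open>An orthonormal basis is an orthonormal family whose finite linear combinations are dense.\<close>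

definition L2_orthonormal_basis :: "'a measure \<Rightarrow> 'i set \<Rightarrow> ('i \<Rightarrow> 'a \<Rightarrow> complex) \<Rightarrow> bool" where
  "L2_orthonormal_basis M I e \<longleftrightarrow>
     (\<forall>i\<in>I. e i \<in> square_integrable M) \<and>
     (\<forall>i\<in>I. \<forall>j\<in>I. L2_inner M (e i) (e j) = (if i = j then 1 else 0)) \<and>
     (\<forall>f\<in>square_integrable M. \<forall>\<epsilon>>0. \<exists>F c. finite F \<and> F \<subseteq> I \<and>
        L2_norm M (\<lambda>x. f x - (\<Sum>i\<in>F. c i * e i x)) < \<epsilon>)"

definition exponential_on :: "real set \<Rightarrow> real \<Rightarrow> real \<Rightarrow> complex" where
  "exponential_on \<Omega> t x =
     of_real (1 / sqrt (measure lebesgue \<Omega>)) * exp (2 * of_real pi * \<i> * of_real (t * x))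
       * indicator \<Omega> x"

definition is_spectrum :: "real set \<Rightarrow> real set \<Rightarrow> bool" where
  "is_spectrum \<Omega> \<Lambda> \<longleftrightarrow>
     \<Omega> \<in> lmeasurable \<and> measure lebesgue \<Omega> > 0 \<and>
     L2_orthonormal_basis (lebesgue_on \<Omega>) \<Lambda> (exponential_on \<Omega>)"

text \<open>
  The infimum is taken in the extended reals, so that for a set with at most one element it is
  \<open>\<infinity>\<close> and not an unspecified real number.
\<close>

definition separated_set :: "real \<Rightarrow> real set \<Rightarrow> bool" where
  "separated_set \<delta> \<Delta> \<longleftrightarrow>
     discrete \<Delta> \<and> \<delta> > 0 \<and>
     Inf {ereal \<bar>x - y\<bar> | x y. x \<in> \<Delta> \<and> y \<in> \<Delta> \<and> x \<noteq> y} = ereal \<delta>"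

definition is_lattice_with_base :: "real set \<Rightarrow> bool" where
  "is_lattice_with_base L \<longleftrightarrow>
     (\<exists>M B. M > 0 \<and> finite B \<and> L = {b + M * of_int k | b k. b \<in> insert 0 B})"

end

theory Submission
  imports Defs "HOL-Library.Function_Algebras"
begin

text \<open>
  Let \<open>t k\<close> run over the \<open>2n\<close> endpoints of the intervals and let \<open>w k\<close> be \<open>1\<close> at right and \<open>-1\<close> at left
  endpoints. Integrating an exponential over \<open>\<Omega>\<close> shows that for \<open>x \<noteq> y\<close> the exponentials of
  frequencies \<open>x\<close> and \<open>y\<close> are orthogonal on \<open>\<Omega>\<close> exactly when
  \<open>\<Sum>k. w k * cis (2 * pi * t k * (x - y)) = 0\<close>. With \<open>\<phi> x = (cis (2 * pi * t k * x))\<^sub>k\<close>, a vector in a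
  space of dimension \<open>2n\<close>, this says that \<open>\<phi> x\<close> and \<open>\<phi> y\<close> are orthogonal for the indefinite Hermitian
  form with weights \<open>w\<close>; the form also vanishes on each single \<open>\<phi> x\<close>, as the weights add up to \<open>0\<close>.
  So \<open>\<phi> ` \<Lambda>\<close> spans a totally isotropic space. Since an orthonormal basis is a maximal orthonormal
  family, every real \<open>x\<close> with \<open>\<phi> x\<close> in that span belongs to \<open>\<Lambda>\<close> (\<open>spectrum_maximal\<close>).

  To produce a progression it is therefore enough to keep \<open>\<phi> (c + d * k)\<close> in the span of \<open>\<phi> ` \<Lambda>\<close> for
  all integers \<open>k\<close>. Translation by \<open>d\<close> acts on the vectors \<open>\<phi> x\<close> by an invertible diagonal map \<open>T d\<close>.
  If a subset \<open>I\<close> of \<open>\<Lambda>\<close> and its translate \<open>I + d\<close> lie in \<open>\<Lambda>\<close> and have images with the same span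
  \<open>V\<close>, then \<open>T d\<close> and its inverse preserve \<open>V\<close>, and the progression through any point of \<open>I\<close> with step
  \<open>d\<close> stays in \<open>\<Lambda>\<close>.

  Such a pair is found by pigeonhole (\<open>exists_shifted_subset_same_span\<close>). As
  \<open>\<Lambda> - \<Lambda>\<close> is separated, a window of fixed length shows only finitely many patterns of points of \<open>\<Lambda>\<close> up
  to translation. The images of two occurrences of one pattern could span different spaces; this is
  excluded by taking the largest rank \<open>m\<close> that is attained in all windows of some length \<open>R\<close>. Because
  rank \<open>m + 1\<close> is not attained everywhere, there are arbitrarily long windows of rank \<open>m\<close>, and in
  such a window all subwindows of length \<open>R\<close> span the same space. The rank \<open>m\<close> is positive because
  \<open>\<Lambda>\<close> is relatively dense, which follows from the completeness of the basis and the decay of the inner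
  products (\<open>spectrum_relatively_dense\<close>).

  Once \<open>\<Lambda>\<close> contains \<open>c + d\<int>\<close>, every element of \<open>\<Lambda>\<close> differs from some element of this progression by
  at most \<open>d\<close>, and \<open>\<Lambda> - \<Lambda>\<close> has only finitely many elements of that size; translating them by \<open>c\<close>
  yields the base of a lattice that contains \<open>\<Lambda>\<close>.
\<close>

section \<open>Separated sets of reals\<close>

lemma separated_floor_neq:
  fixes p q \<delta> :: real
  assumes "\<delta> > 0" "\<delta> \<le> \<bar>p - q\<bar>"
  shows "\<lfloor>p / \<delta>\<rfloor> \<noteq> \<lfloor>q / \<delta>\<rfloor>"
proof
  assume "\<lfloor>p / \<delta>\<rfloor> = \<lfloor>q / \<delta>\<rfloor>"
  then have "\<bar>p / \<delta> - q / \<delta>\<bar> < 1" by linarith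
  then have "\<bar>p - q\<bar> < \<delta>"
    using \<open>\<delta> > 0\<close> by (simp flip: diff_divide_distrib)
  with assms show False by simp
qed

lemma separated_setD:
  assumes "separated_set \<delta> S" "x \<in> S" "y \<in> S" "x \<noteq> y"
  shows "\<delta> \<le> \<bar>x - y\<bar>"
proof -
  have "ereal \<delta> \<le> ereal \<bar>x - y\<bar>"
    using assms unfolding separated_set_def by (metis (mono_tags, lifting) Inf_lower mem_Collect_eq)
  then show ?thesis by simp
qed

text \<open>
  The points \<open>h u\<close> occupy different cells of length \<open>\<delta>\<close>, so the sum is dominated by a tail of the
  convergent series \<open>\<Sum>m. 1 / (\<delta> * m)\<^sup>2\<close>. The bound \<open>R\<close> must serve all \<open>F\<close> and \<open>h\<close> at once: in
  \<open>spectrum_relatively_dense\<close> they are the finite parts of a spectrum seen from an arbitrary point.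
\<close>

lemma sum_inverse_squares_separated_small:
  fixes \<delta> \<eta> :: real
  assumes "\<delta> > 0" "\<eta> > 0"
  obtains R where "R > 0"
    "\<And>F (h :: 'a \<Rightarrow> real). \<lbrakk>finite F; \<And>u. u \<in> F \<Longrightarrow> R \<le> h u;
       \<And>u v. \<lbrakk>u \<in> F; v \<in> F; u \<noteq> v\<rbrakk> \<Longrightarrow> \<delta> \<le> \<bar>h u - h v\<bar>\<rbrakk>
     \<Longrightarrow> (\<Sum>u\<in>F. 1 / (h u)\<^sup>2) \<le> \<eta>"
proof -
  let ?f = "\<lambda>m::nat. 1 / (\<delta> * real m)\<^sup>2"
  have "summable (\<lambda>m::nat. inverse (real m ^ 2))"
    by (rule inverse_power_summable) simp
  then have "summable (\<lambda>m::nat. inverse (\<delta>\<^sup>2) * inverse (real m ^ 2))"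
    by (rule summable_mult)
  then have "summable ?f"
    by (simp add: power_mult_distrib divide_inverse)
  then obtain N where N: "\<And>m k. m \<ge> N \<Longrightarrow> norm (sum ?f {m..<k}) < \<eta>"
    unfolding summable_Cauchy using \<open>\<eta> > 0\<close> by meson
  \<comment> \<open>The cell with index \<open>0\<close> would contribute \<open>1 / 0\<close>, so it is left out.\<close>
  define K where "K = max N 1"
  show thesis
  proof (rule that[of "\<delta> * real K"])
    show "\<delta> * real K > 0" using assms by (simp add: K_def)
  next
    fix F :: "'a set" and h :: "'a \<Rightarrow> real"
    assume fin: "finite F" and far: "\<And>u. u \<in> F \<Longrightarrow> \<delta> * real K \<le> h u"
      and sep: "\<And>u v. \<lbrakk>u \<in> F; v \<in> F; u \<noteq> v\<rbrakk> \<Longrightarrow> \<delta> \<le> \<bar>h u - h v\<bar>"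
    define g where "g u = nat \<lfloor>h u / \<delta>\<rfloor>" for u
    have ge: "real K \<le> h u / \<delta>" if "u \<in> F" for u
      using far[OF that] \<open>\<delta> > 0\<close> by (simp add: field_simps)
    have cell: "real (g u) \<le> h u / \<delta>" "h u / \<delta> < real (g u) + 1" "K \<le> g u" if "u \<in> F" for u
      using ge[OF that] unfolding g_def by linarith+
    have inj: "inj_on g F"
    proof (rule inj_onI, rule ccontr)
      fix u v assume uv: "u \<in> F" "v \<in> F" "g u = g v" "u \<noteq> v"
      then have "\<lfloor>h u / \<delta>\<rfloor> = \<lfloor>h v / \<delta>\<rfloor>"
        using cell[OF uv(1)] cell[OF uv(2)] unfolding g_def by linarith
      then show False
        using separated_floor_neq[OF \<open>\<delta> > 0\<close> sep[OF uv(1,2,4)]] by simp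
    qed
    have "(\<Sum>u\<in>F. 1 / (h u)\<^sup>2) \<le> (\<Sum>u\<in>F. ?f (g u))"
    proof (rule sum_mono)
      fix u assume u: "u \<in> F"
      have "g u > 0" using cell(3)[OF u] by (simp add: K_def)
      moreover have "\<delta> * real (g u) \<le> h u"
        using cell(1)[OF u] \<open>\<delta> > 0\<close> by (simp add: field_simps)
      moreover have pos: "0 < \<delta> * real (g u)"
        using \<open>g u > 0\<close> \<open>\<delta> > 0\<close> by simp
      ultimately have "(\<delta> * real (g u))\<^sup>2 \<le> (h u)\<^sup>2"
        by (intro power_mono) auto
      then show "1 / (h u)\<^sup>2 \<le> ?f (g u)"
        using zero_less_power[OF pos, of 2] by (intro frac_le) auto
    qed
    also have "\<dots> = sum ?f (g ` F)"
      by (simp add: sum.reindex[OF inj])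
    also have "\<dots> \<le> sum ?f {K..<Suc (Max (insert 0 (g ` F)))}"
      using fin cell(3) by (intro sum_mono2) (auto simp: less_Suc_eq_le)
    also have "\<dots> \<le> \<eta>"
      using N[of K "Suc (Max (insert 0 (g ` F)))"] by (simp add: K_def)
    finally show "(\<Sum>u\<in>F. 1 / (h u)\<^sup>2) \<le> \<eta>" .
  qed
qed

lemma finite_separated_bounded:
  fixes S :: "real set"
  assumes "\<delta> > 0" and sep: "\<And>x y. x \<in> S \<Longrightarrow> y \<in> S \<Longrightarrow> x \<noteq> y \<Longrightarrow> \<delta> \<le> \<bar>x - y\<bar>"
    and bd: "\<And>x. x \<in> S \<Longrightarrow> \<bar>x\<bar> \<le> R"
  shows "finite S"
proof (rule inj_on_finite)
  show "inj_on (\<lambda>x. \<lfloor>x / \<delta>\<rfloor>) S"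
    using separated_floor_neq[OF \<open>\<delta> > 0\<close> sep] by (meson inj_onI)
  show "(\<lambda>x. \<lfloor>x / \<delta>\<rfloor>) ` S \<subseteq> {\<lfloor>- R / \<delta>\<rfloor>..\<lfloor>R / \<delta>\<rfloor>}"
  proof (rule image_subsetI)
    fix x assume "x \<in> S"
    then have "- R \<le> x" "x \<le> R" using bd[of x] by auto
    then have "- R / \<delta> \<le> x / \<delta>" "x / \<delta> \<le> R / \<delta>"
      using \<open>\<delta> > 0\<close> by (simp_all add: divide_right_mono field_simps)
    then show "\<lfloor>x / \<delta>\<rfloor> \<in> {\<lfloor>- R / \<delta>\<rfloor>..\<lfloor>R / \<delta>\<rfloor>}"
      using floor_mono by auto
  qed
qed simp

section \<open>A lower bound for the distance to an orthonormal family\<close>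

lemma square_integrable_inner_integrable:
  assumes f: "f \<in> square_integrable M" and g: "g \<in> square_integrable M"
  shows "integrable M (\<lambda>x. f x * cnj (g x))"
proof (rule Bochner_Integration.integrable_bound)
  have [measurable]: "f \<in> borel_measurable M" "g \<in> borel_measurable M"
    using f g by (auto simp: square_integrable_def)
  show "integrable M (\<lambda>x. (cmod (f x))\<^sup>2 + (cmod (g x))\<^sup>2)"
    using f g by (auto simp: square_integrable_def)
  have "(\<lambda>x. cnj (g x)) \<in> borel_measurable M"
    by (rule borel_measurable_continuous_on[where f = cnj]) (auto intro: continuous_intros)
  then show "(\<lambda>x. f x * cnj (g x)) \<in> borel_measurable M"
    by measurable
  have "p * q \<le> p\<^sup>2 + q\<^sup>2" if "p \<ge> 0" "q \<ge> 0" for p q :: real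
  proof -
    have "2 * (p * q) \<le> p\<^sup>2 + q\<^sup>2"
      using sum_squares_bound[of p q] by (simp add: mult.assoc)
    moreover have "p * q \<ge> 0" using that by simp
    ultimately show ?thesis by linarith
  qed
  then show "AE x in M. norm (f x * cnj (g x)) \<le> norm ((cmod (f x))\<^sup>2 + (cmod (g x))\<^sup>2)"
    by (simp add: norm_mult)
qed

lemma square_integrable_diff_scale:
  assumes f: "f \<in> square_integrable M" and g: "g \<in> square_integrable M"
  shows "(\<lambda>x. f x - c * g x) \<in> square_integrable M"
proof -
  have [measurable]: "f \<in> borel_measurable M" "g \<in> borel_measurable M"
    using f g by (auto simp: square_integrable_def)
  have "integrable M (\<lambda>x. (cmod (f x - c * g x))\<^sup>2)"
  proof (rule Bochner_Integration.integrable_bound)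
    show "integrable M (\<lambda>x. 2 * (cmod (f x))\<^sup>2 + 2 * ((cmod c)\<^sup>2 * (cmod (g x))\<^sup>2))"
      using f g by (auto simp: square_integrable_def)
    have "(cmod (z - w))\<^sup>2 \<le> 2 * (cmod z)\<^sup>2 + 2 * (cmod w)\<^sup>2" for z w
    proof -
      have "(cmod (z - w))\<^sup>2 \<le> (cmod z + cmod w)\<^sup>2"
        by (intro power_mono norm_triangle_ineq4) auto
      also have "\<dots> \<le> 2 * (cmod z)\<^sup>2 + 2 * (cmod w)\<^sup>2"
        using sum_squares_bound[of "cmod z" "cmod w"] by (simp add: power2_sum)
      finally show ?thesis .
    qed
    from this[of "f x" "c * g x" for x]
    show "AE x in M. norm ((cmod (f x - c * g x))\<^sup>2)
        \<le> norm (2 * (cmod (f x))\<^sup>2 + 2 * ((cmod c)\<^sup>2 * (cmod (g x))\<^sup>2))"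
      by (simp add: norm_mult power_mult_distrib)
  qed measurable
  then show ?thesis by (simp add: square_integrable_def)
qed

lemma L2_inner_self: "L2_inner M f f = of_real (LINT x|M. (cmod (f x))\<^sup>2)"
  unfolding L2_inner_def
  by (simp flip: complex_norm_square integral_complex_of_real)

lemma L2_inner_commute: "L2_inner M g f = cnj (L2_inner M f g)"
  unfolding L2_inner_def by (simp flip: Bochner_Integration.integral_cnj add: mult.commute)

lemma L2_inner_diff_scale_left:
  assumes "f \<in> square_integrable M" "g \<in> square_integrable M" "h \<in> square_integrable M"
  shows "L2_inner M (\<lambda>x. f x - c * g x) h = L2_inner M f h - c * L2_inner M g h"
  using square_integrable_inner_integrable[OF assms(1,3)]
    square_integrable_inner_integrable[OF assms(2,3)]
  by (simp add: L2_inner_def left_diff_distrib mult.assoc)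

text \<open>
  Completing the square: with \<open>z\<close> the coefficient of \<open>f\<close> along the unit vector \<open>g\<close>, the two sides differ
  by \<open>(cmod (z - c))\<^sup>2\<close>.
\<close>

lemma norm_sq_diff_normalized_ge:
  assumes f: "f \<in> square_integrable M" and g: "g \<in> square_integrable M"
    and unit: "L2_inner M g g = 1"
  shows "(LINT x|M. (cmod (f x))\<^sup>2) - (cmod (L2_inner M f g))\<^sup>2
    \<le> (LINT x|M. (cmod (f x - c * g x))\<^sup>2)"
proof -
  let ?h = "\<lambda>x. f x - c * g x" and ?z = "L2_inner M f g"
  have h: "?h \<in> square_integrable M" by (rule square_integrable_diff_scale[OF f g])
  have hf: "L2_inner M ?h f = L2_inner M f f - c * cnj ?z"
    using L2_inner_diff_scale_left[OF f g f] by (simp add: L2_inner_commute[of M g f])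
  have hg: "L2_inner M ?h g = ?z - c"
    using L2_inner_diff_scale_left[OF f g g] unit by simp
  have "L2_inner M ?h ?h = cnj (L2_inner M f ?h - c * L2_inner M g ?h)"
    using L2_inner_diff_scale_left[OF f g h] by (metis L2_inner_commute)
  also have "\<dots> = L2_inner M ?h f - cnj c * L2_inner M ?h g"
    by (simp add: L2_inner_commute[of M ?h])
  also have "\<dots> = L2_inner M f f - ?z * cnj ?z + (?z - c) * cnj (?z - c)"
    unfolding hf hg by (simp add: algebra_simps)
  finally have "of_real (LINT x|M. (cmod (?h x))\<^sup>2)
      = (of_real ((LINT x|M. (cmod (f x))\<^sup>2) - (cmod ?z)\<^sup>2 + (cmod (?z - c))\<^sup>2) :: complex)"
    unfolding L2_inner_self complex_norm_square[symmetric] by simp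
  then have "(LINT x|M. (cmod (?h x))\<^sup>2)
      = (LINT x|M. (cmod (f x))\<^sup>2) - (cmod ?z)\<^sup>2 + (cmod (?z - c))\<^sup>2"
    by (simp only: of_real_eq_iff)
  then show ?thesis by simp
qed

text \<open>
  The best approximation of \<open>f\<close> by combinations of an orthonormal family has its inner products with
  the family as coefficients, whatever coefficients \<open>c\<close> are tried. Removing one member of the family
  from \<open>f\<close> leaves the inner products with the other members unchanged, so an induction reduces the
  claim to a single unit vector.
\<close>

lemma norm_sq_minus_Bessel_sum_le:
  assumes "finite F" and "\<And>i. i \<in> F \<Longrightarrow> e i \<in> square_integrable M"
    and "\<And>i j. i \<in> F \<Longrightarrow> j \<in> F \<Longrightarrow> L2_inner M (e i) (e j) = (if i = j then 1 else 0)"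
    and "f \<in> square_integrable M"
  shows "(LINT x|M. (cmod (f x))\<^sup>2) - (\<Sum>i\<in>F. (cmod (L2_inner M f (e i)))\<^sup>2)
    \<le> (LINT x|M. (cmod (f x - (\<Sum>i\<in>F. c i * e i x)))\<^sup>2)"
  using assms
proof (induction F arbitrary: f rule: finite_induct)
  case empty
  then show ?case by simp
next
  case (insert i F)
  let ?g = "\<lambda>x. f x - c i * e i x"
  have g: "?g \<in> square_integrable M"
    using insert.prems by (intro square_integrable_diff_scale) auto
  have coeff: "L2_inner M ?g (e k) = L2_inner M f (e k)" if "k \<in> F" for k
    using L2_inner_diff_scale_left[of f M "e i" "e k" "c i"] insert.prems insert.hyps that by auto
  have "(LINT x|M. (cmod (?g x))\<^sup>2) - (\<Sum>k\<in>F. (cmod (L2_inner M f (e k)))\<^sup>2)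
      \<le> (LINT x|M. (cmod (?g x - (\<Sum>k\<in>F. c k * e k x)))\<^sup>2)"
    using insert.IH[OF _ _ g] insert.prems coeff by simp
  moreover have "(LINT x|M. (cmod (f x))\<^sup>2) - (cmod (L2_inner M f (e i)))\<^sup>2
      \<le> (LINT x|M. (cmod (?g x))\<^sup>2)"
    using insert.prems by (intro norm_sq_diff_normalized_ge) auto
  ultimately show ?case
    using insert.hyps by (simp add: diff_diff_eq)
qed

section \<open>Inner products of exponentials on a union of intervals\<close>

lemma exponential_on_square_integrable:
  assumes "\<Omega> \<in> lmeasurable"
  shows "exponential_on \<Omega> x \<in> square_integrable (lebesgue_on \<Omega>)"
proof -
  interpret finite_measure "lebesgue_on \<Omega>"
    using assms by (rule finite_measure_lebesgue_on)
  have "continuous_on UNIV (\<lambda>u. of_real (1 / sqrt (measure lebesgue \<Omega>)) *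
      exp (2 * of_real pi * \<i> * of_real (x * u)) :: complex)"
    by (intro continuous_intros)
  then have "(\<lambda>u. of_real (1 / sqrt (measure lebesgue \<Omega>)) *
      exp (2 * of_real pi * \<i> * of_real (x * u)) :: complex) \<in> borel_measurable lebesgue"
    by (intro measurable_completion) (simp add: borel_measurable_continuous_onI)
  moreover have "(indicator \<Omega> :: real \<Rightarrow> complex) \<in> borel_measurable lebesgue"
    using assms by (simp add: fmeasurableD)
  ultimately have "exponential_on \<Omega> x \<in> borel_measurable lebesgue"
    unfolding exponential_on_def by (rule borel_measurable_times)
  then have meas: "exponential_on \<Omega> x \<in> borel_measurable (lebesgue_on \<Omega>)"
    by (rule measurable_restrict_space1)
  have "cmod (exponential_on \<Omega> x u) \<le> 1 / sqrt (measure lebesgue \<Omega>)" for u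
    by (simp add: exponential_on_def norm_mult indicator_def norm_divide)
  then have "(cmod (exponential_on \<Omega> x u))\<^sup>2 \<le> (1 / sqrt (measure lebesgue \<Omega>))\<^sup>2" for u
    by (rule power_mono) simp
  then have "integrable (lebesgue_on \<Omega>) (\<lambda>u. (cmod (exponential_on \<Omega> x u))\<^sup>2)"
    using meas by (intro integrable_const_bound[where B = "(1 / sqrt (measure lebesgue \<Omega>))\<^sup>2"]) auto
  with meas show ?thesis by (simp add: square_integrable_def)
qed

lemma exponential_on_mult_cnj:
  assumes "u \<in> \<Omega>"
  shows "exponential_on \<Omega> x u * cnj (exponential_on \<Omega> y u)
    = of_real (1 / measure lebesgue \<Omega>) * exp (2 * of_real pi * \<i> * of_real ((x - y) * u))"
proof -
  have "of_real (1 / sqrt (measure lebesgue \<Omega>)) * of_real (1 / sqrt (measure lebesgue \<Omega>))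
      = (of_real (1 / measure lebesgue \<Omega>) :: complex)"
    by (simp flip: of_real_mult)
  moreover have "exp (2 * of_real pi * \<i> * of_real (x * u))
      * cnj (exp (2 * of_real pi * \<i> * of_real (y * u)))
      = exp (2 * of_real pi * \<i> * of_real ((x - y) * u))"
    by (simp add: exp_cnj flip: exp_add) (simp add: algebra_simps)
  ultimately show ?thesis
    using assms by (simp add: exponential_on_def mult.assoc mult.left_commute)
qed

lemma norm_exponential_on:
  assumes "\<Omega> \<in> lmeasurable" "measure lebesgue \<Omega> > 0"
  shows "(LINT u|lebesgue_on \<Omega>. (cmod (exponential_on \<Omega> x u))\<^sup>2) = 1"
proof -
  have "(LINT u|lebesgue_on \<Omega>. (cmod (exponential_on \<Omega> x u))\<^sup>2)
      = (LINT u|lebesgue_on \<Omega>. 1 / measure lebesgue \<Omega>)"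
    by (rule Bochner_Integration.integral_cong)
      (use assms in \<open>auto simp: exponential_on_def norm_mult norm_divide power_divide\<close>)
  also have "\<dots> = 1"
    using assms by (simp add: measure_restrict_space fmeasurableD)
  finally show ?thesis .
qed

lemma exp_has_integral_interval:
  fixes s \<alpha> \<beta> :: real
  assumes "s \<noteq> 0" "\<alpha> \<le> \<beta>"
  shows "((\<lambda>u. exp (2 * of_real pi * \<i> * of_real (s * u))) has_integral
    (exp (2 * of_real pi * \<i> * of_real (s * \<beta>)) - exp (2 * of_real pi * \<i> * of_real (s * \<alpha>)))
      / (2 * of_real pi * \<i> * of_real s)) {\<alpha>..<\<beta>}"
proof -
  let ?c = "2 * of_real pi * \<i> * of_real s :: complex"
  let ?g = "\<lambda>u::real. exp (2 * of_real pi * \<i> * of_real (s * u)) / ?c"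
  have "?c \<noteq> 0" using assms by simp
  have "(?g has_vector_derivative exp (2 * of_real pi * \<i> * of_real (s * u)))
      (at u within {\<alpha>..\<beta>})" for u
  proof -
    have "((\<lambda>z. exp (?c * z) / ?c) has_field_derivative exp (?c * of_real u)) (at (of_real u))"
      using \<open>?c \<noteq> 0\<close> by (auto intro!: derivative_eq_intros)
    then have "((\<lambda>z. exp (?c * z) / ?c) \<circ> of_real has_vector_derivative 1 * exp (?c * of_real u))
      (at u within {\<alpha>..\<beta>})"
      by (intro field_vector_diff_chain_within has_vector_derivative_of_real)
       (auto intro: has_field_derivative_at_within derivative_eq_intros)
    then show ?thesis by (simp add: o_def mult.assoc)
  qed
  then have "((\<lambda>u. exp (2 * of_real pi * \<i> * of_real (s * u))) has_integral ?g \<beta> - ?g \<alpha>) {\<alpha>..\<beta>}"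
    by (intro fundamental_theorem_of_calculus assms)
  then have "((\<lambda>u. exp (2 * of_real pi * \<i> * of_real (s * u))) has_integral ?g \<beta> - ?g \<alpha>) {\<alpha>..<\<beta>}"
    by (subst has_integral_spike_set_eq[of _ "{\<alpha>..\<beta>}"]) (auto intro: negligible_subset[of "{\<beta>}"])
  then show ?thesis
    by (simp add: diff_divide_distrib)
qed

lemma lebesgue_integral_exp_disjoint_intervals:
  fixes \<alpha> \<beta> :: "'j \<Rightarrow> real" and s :: real
  assumes fin: "finite J" and "s \<noteq> 0"
    and le: "\<And>j. j \<in> J \<Longrightarrow> \<alpha> j \<le> \<beta> j"
    and disj: "disjoint_family_on (\<lambda>j. {\<alpha> j..<\<beta> j}) J"
    and \<Omega>: "\<Omega> = (\<Union>j\<in>J. {\<alpha> j..<\<beta> j})"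
  shows "(LINT u|lebesgue_on \<Omega>. exp (2 * of_real pi * \<i> * of_real (s * u))) =
    (\<Sum>j\<in>J. exp (2 * of_real pi * \<i> * of_real (s * \<beta> j)) - exp (2 * of_real pi * \<i> * of_real (s * \<alpha> j)))
      / (2 * of_real pi * \<i> * of_real s)"
proof -
  let ?e = "\<lambda>u. exp (2 * of_real pi * \<i> * of_real (s * u)) :: complex"
  have meas: "\<Omega> \<in> lmeasurable" unfolding \<Omega> using fin
    by (intro fmeasurable.finite_UN bounded_set_imp_lmeasurable bounded_Ico) auto
  interpret finite_measure "lebesgue_on \<Omega>"
    using meas by (rule finite_measure_lebesgue_on)
  have "continuous_on UNIV ?e" by (intro continuous_intros)
  then have "?e \<in> borel_measurable lebesgue"
    by (intro measurable_completion) (simp add: borel_measurable_continuous_onI)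
  then have "?e \<in> borel_measurable (lebesgue_on \<Omega>)" by (rule measurable_restrict_space1)
  then have "integrable (lebesgue_on \<Omega>) ?e"
    by (intro integrable_const_bound[where B = 1]) auto
  then have Henstock: "(LINT u|lebesgue_on \<Omega>. ?e u) = integral \<Omega> ?e"
    using meas by (intro lebesgue_integral_eq_integral) auto
  have "pairwise (\<lambda>i j. negligible ({\<alpha> i..<\<beta> i} \<inter> {\<alpha> j..<\<beta> j})) J"
    using disj unfolding pairwise_def disjoint_family_on_def by (metis negligible_empty)
  then have "(?e has_integral
      (\<Sum>j\<in>J. (?e (\<beta> j) - ?e (\<alpha> j)) / (2 * of_real pi * \<i> * of_real s))) \<Omega>"
    unfolding \<Omega> by (intro has_integral_UN fin exp_has_integral_interval \<open>s \<noteq> 0\<close> le)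
  then have "integral \<Omega> ?e = (\<Sum>j\<in>J. (?e (\<beta> j) - ?e (\<alpha> j)) / (2 * of_real pi * \<i> * of_real s))"
    by (rule integral_unique)
  with Henstock show ?thesis by (simp add: sum_divide_distrib)
qed

lemma L2_inner_exponential_on:
  fixes \<alpha> \<beta> :: "'j \<Rightarrow> real"
  assumes "finite J" "\<And>j. j \<in> J \<Longrightarrow> \<alpha> j \<le> \<beta> j"
    "disjoint_family_on (\<lambda>j. {\<alpha> j..<\<beta> j}) J" "\<Omega> = (\<Union>j\<in>J. {\<alpha> j..<\<beta> j})" "x \<noteq> y"
  shows "L2_inner (lebesgue_on \<Omega>) (exponential_on \<Omega> x) (exponential_on \<Omega> y) =
    (\<Sum>j\<in>J. exp (2 * of_real pi * \<i> * of_real ((x - y) * \<beta> j))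
        - exp (2 * of_real pi * \<i> * of_real ((x - y) * \<alpha> j)))
      / (2 * of_real (pi * measure lebesgue \<Omega>) * \<i> * of_real (x - y))"
proof -
  have "L2_inner (lebesgue_on \<Omega>) (exponential_on \<Omega> x) (exponential_on \<Omega> y)
      = (LINT u|lebesgue_on \<Omega>. of_real (1 / measure lebesgue \<Omega>)
          * exp (2 * of_real pi * \<i> * of_real ((x - y) * u)))"
    unfolding L2_inner_def
    by (rule Bochner_Integration.integral_cong) (auto simp: exponential_on_mult_cnj)
  also have "\<dots> = of_real (1 / measure lebesgue \<Omega>)
      * (LINT u|lebesgue_on \<Omega>. exp (2 * of_real pi * \<i> * of_real ((x - y) * u)))"
    by (rule integral_mult_right_zero)
  finally show ?thesis
    using lebesgue_integral_exp_disjoint_intervals[of J "x - y" \<alpha> \<beta> \<Omega>] assms by simp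
qed

text \<open>
  Each of the \<open>card J\<close> intervals contributes a difference of two numbers of modulus \<open>1\<close> to the numerator.
\<close>

lemma norm_L2_inner_exponential_on_le:
  fixes \<alpha> \<beta> :: "'j \<Rightarrow> real"
  assumes "finite J" "\<And>j. j \<in> J \<Longrightarrow> \<alpha> j \<le> \<beta> j"
    "disjoint_family_on (\<lambda>j. {\<alpha> j..<\<beta> j}) J" "\<Omega> = (\<Union>j\<in>J. {\<alpha> j..<\<beta> j})"
    "x \<noteq> y" "measure lebesgue \<Omega> > 0"
  shows "cmod (L2_inner (lebesgue_on \<Omega>) (exponential_on \<Omega> x) (exponential_on \<Omega> y))
    \<le> (real (card J) / (pi * measure lebesgue \<Omega>)) / \<bar>x - y\<bar>"
proof -
  let ?e = "\<lambda>u. exp (2 * of_real pi * \<i> * of_real ((x - y) * u)) :: complex"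
  have "cmod (\<Sum>j\<in>J. ?e (\<beta> j) - ?e (\<alpha> j)) \<le> real (card J) * 2"
  proof (rule sum_norm_bound)
    fix j
    show "cmod (?e (\<beta> j) - ?e (\<alpha> j)) \<le> 2"
      using norm_triangle_ineq4[of "?e (\<beta> j)" "?e (\<alpha> j)"] by simp
  qed
  then have "cmod (\<Sum>j\<in>J. ?e (\<beta> j) - ?e (\<alpha> j)) / (2 * (pi * measure lebesgue \<Omega>) * \<bar>x - y\<bar>)
      \<le> real (card J) * 2 / (2 * (pi * measure lebesgue \<Omega>) * \<bar>x - y\<bar>)"
    using assms(6) by (intro divide_right_mono) auto
  moreover have "cmod (L2_inner (lebesgue_on \<Omega>) (exponential_on \<Omega> x) (exponential_on \<Omega> y))
      = cmod (\<Sum>j\<in>J. ?e (\<beta> j) - ?e (\<alpha> j)) / (2 * (pi * measure lebesgue \<Omega>) * \<bar>x - y\<bar>)"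
    using assms(6)
    by (subst L2_inner_exponential_on[where J = J and \<alpha> = \<alpha> and \<beta> = \<beta>, OF assms(1) _ assms(3-5)])
      (use assms(2) in \<open>auto simp only: norm_divide norm_mult norm_of_real norm_ii norm_numeral abs_mult\<close>, simp)
  ultimately show ?thesis by (simp add: mult.assoc)
qed

lemma ordered_intervals_disjoint:
  fixes a r :: "nat \<Rightarrow> real"
  assumes pos: "\<And>j. 1 \<le> j \<Longrightarrow> j \<le> n \<Longrightarrow> r j > 0"
    and gap: "\<And>j. 1 \<le> j \<Longrightarrow> j < n \<Longrightarrow> a j + r j < a (j + 1)"
  shows "disjoint_family_on (\<lambda>j. {a j..<a j + r j}) {1..n}"
proof -
  have before: "a i + r i \<le> a j" if "Suc i \<le> j" "1 \<le> i" "j \<le> n" for i j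
    using that
  proof (induction j rule: dec_induct)
    case base
    then show ?case using gap[of i] by simp
  next
    case (step j)
    then show ?case using gap[of j] pos[of j] by simp
  qed
  show ?thesis
  proof (unfold disjoint_family_on_def, intro ballI impI)
    fix i j assume ij: "i \<in> {1..n}" "j \<in> {1..n}" "i \<noteq> j"
    then consider "Suc i \<le> j" | "Suc j \<le> i" by linarith
    then show "{a i..<a i + r i} \<inter> {a j..<a j + r j} = {}"
      using before[of i j] before[of j i] ij by cases auto
  qed
qed

section \<open>Maximality and relative density of spectra\<close>

text \<open>
  By density a finite combination of the basis approximates the unit vector \<open>exponential_on \<Omega> x\<close>
  with squared error below \<open>1 / 2\<close>. This form of completeness gives both the maximality and the
  relative density of a spectrum.
\<close>

lemma spectrum_Bessel_gt_half:
  assumes "is_spectrum \<Omega> \<Lambda>"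
  obtains F where "finite F" "F \<subseteq> \<Lambda>"
    "(\<Sum>u\<in>F. (cmod (L2_inner (lebesgue_on \<Omega>) (exponential_on \<Omega> x) (exponential_on \<Omega> u)))\<^sup>2) > 1 / 2"
proof -
  let ?M = "lebesgue_on \<Omega>" and ?e = "exponential_on \<Omega>"
  have \<Omega>: "\<Omega> \<in> lmeasurable" "measure lebesgue \<Omega> > 0"
    and basis: "L2_orthonormal_basis ?M \<Lambda> ?e"
    using assms by (auto simp: is_spectrum_def)
  have sq: "?e t \<in> square_integrable ?M" for t
    by (rule exponential_on_square_integrable[OF \<Omega>(1)])
  have orth: "L2_inner ?M (?e u) (?e v) = (if u = v then 1 else 0)" if "u \<in> \<Lambda>" "v \<in> \<Lambda>" for u v
    using basis that by (simp add: L2_orthonormal_basis_def)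
  have "sqrt (1 / 2) > (0 :: real)" by simp
  then obtain F c where F: "finite F" "F \<subseteq> \<Lambda>"
    and close: "L2_norm ?M (\<lambda>t. ?e x t - (\<Sum>u\<in>F. c u * ?e u t)) < sqrt (1 / 2)"
    using basis sq[of x] unfolding L2_orthonormal_basis_def by meson
  have "(LINT t|?M. (cmod (?e x t))\<^sup>2) - (\<Sum>u\<in>F. (cmod (L2_inner ?M (?e x) (?e u)))\<^sup>2)
      \<le> (LINT t|?M. (cmod (?e x t - (\<Sum>u\<in>F. c u * ?e u t)))\<^sup>2)"
    using F(2) by (intro norm_sq_minus_Bessel_sum_le F(1) sq orth) auto
  moreover have "(LINT t|?M. (cmod (?e x t - (\<Sum>u\<in>F. c u * ?e u t)))\<^sup>2) < 1 / 2"
    using close unfolding L2_norm_def by (simp only: real_sqrt_less_iff)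
  ultimately show thesis
    using that[OF F] norm_exponential_on[OF \<Omega>, of x] by simp
qed

lemma spectrum_maximal:
  assumes "is_spectrum \<Omega> \<Lambda>"
    and "\<And>u. u \<in> \<Lambda> \<Longrightarrow> u \<noteq> x \<Longrightarrow>
      L2_inner (lebesgue_on \<Omega>) (exponential_on \<Omega> x) (exponential_on \<Omega> u) = 0"
  shows "x \<in> \<Lambda>"
proof (rule ccontr)
  assume "x \<notin> \<Lambda>"
  obtain F where "F \<subseteq> \<Lambda>" and F:
    "(\<Sum>u\<in>F. (cmod (L2_inner (lebesgue_on \<Omega>) (exponential_on \<Omega> x) (exponential_on \<Omega> u)))\<^sup>2) > 1 / 2"
    by (rule spectrum_Bessel_gt_half[OF assms(1), of x])
  have "(\<Sum>u\<in>F. (cmod (L2_inner (lebesgue_on \<Omega>) (exponential_on \<Omega> x) (exponential_on \<Omega> u)))\<^sup>2) = 0"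
    using \<open>F \<subseteq> \<Lambda>\<close> \<open>x \<notin> \<Lambda>\<close> assms(2) by (intro sum.neutral) auto
  with F show False by simp
qed

text \<open>
  If a long interval around \<open>x\<close> contained no point of \<open>\<Lambda>\<close>, then the inner products of the exponential of
  frequency \<open>x\<close> with the basis would have squares bounded by \<open>C\<^sup>2 / (x - u)\<^sup>2\<close> with all \<open>u\<close> far from \<open>x\<close>, and
  their sum would be too small for a basis.
\<close>

lemma spectrum_relatively_dense:
  assumes spec: "is_spectrum \<Omega> \<Lambda>" and "\<delta> > 0"
    and sep: "\<And>u v. u \<in> \<Lambda> \<Longrightarrow> v \<in> \<Lambda> \<Longrightarrow> u \<noteq> v \<Longrightarrow> \<delta> \<le> \<bar>u - v\<bar>"
    and decay: "\<And>x y. x \<noteq> y \<Longrightarrow>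
      cmod (L2_inner (lebesgue_on \<Omega>) (exponential_on \<Omega> x) (exponential_on \<Omega> y)) \<le> C / \<bar>x - y\<bar>"
  obtains L where "L > 0" "\<And>x. \<exists>u\<in>\<Lambda>. x \<le> u \<and> u < x + L"
proof -
  let ?c = "\<lambda>x u. cmod (L2_inner (lebesgue_on \<Omega>) (exponential_on \<Omega> x) (exponential_on \<Omega> u))"
  \<comment> \<open>Each of the two sides of \<open>x\<close> then contributes at most \<open>C\<^sup>2 * \<eta> \<le> 1 / 4\<close>; adding \<open>1\<close> avoids a division by \<open>0\<close>.\<close>
  define \<eta> where "\<eta> = 1 / (4 * (C\<^sup>2 + 1))"
  have "C\<^sup>2 + 1 > 0" by (simp add: add_nonneg_pos)
  then have "\<eta> > 0" by (simp add: \<eta>_def)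
  obtain R where "R > 0" and R:
    "\<And>F (h :: real \<Rightarrow> real). \<lbrakk>finite F; \<And>u. u \<in> F \<Longrightarrow> R \<le> h u;
       \<And>u v. \<lbrakk>u \<in> F; v \<in> F; u \<noteq> v\<rbrakk> \<Longrightarrow> \<delta> \<le> \<bar>h u - h v\<bar>\<rbrakk>
     \<Longrightarrow> (\<Sum>u\<in>F. 1 / (h u)\<^sup>2) \<le> \<eta>"
    using sum_inverse_squares_separated_small[OF \<open>\<delta> > 0\<close> \<open>\<eta> > 0\<close>, where 'a = real] by blast
  have ex: "\<exists>u\<in>\<Lambda>. \<bar>u - x\<bar> < R" for x
  proof (rule ccontr)
    assume far: "\<not> (\<exists>u\<in>\<Lambda>. \<bar>u - x\<bar> < R)"
    obtain F where F: "finite F" "F \<subseteq> \<Lambda>" "(\<Sum>u\<in>F. (?c x u)\<^sup>2) > 1 / 2"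
      by (rule spectrum_Bessel_gt_half[OF spec, of x])
    have far_F: "\<bar>u - x\<bar> \<ge> R" if "u \<in> F" for u using far F(2) that by force
    define A B where "A = {u \<in> F. u \<ge> x}" and "B = {u \<in> F. u < x}"
    have AB: "F = A \<union> B" "A \<inter> B = {}" "finite A" "finite B"
      using F(1) by (auto simp: A_def B_def)
    have sep_F: "\<delta> \<le> \<bar>u - v\<bar>" if "u \<in> F" "v \<in> F" "u \<noteq> v" for u v
      using sep F(2) that by blast
    have "(\<Sum>u\<in>A. 1 / (u - x)\<^sup>2) \<le> \<eta>"
    proof (rule R[OF \<open>finite A\<close>])
      show "R \<le> u - x" if "u \<in> A" for u using far_F[of u] that by (simp add: A_def)
      show "\<delta> \<le> \<bar>(u - x) - (v - x)\<bar>" if "u \<in> A" "v \<in> A" "u \<noteq> v" for u v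
        using sep_F[of u v] that by (simp add: A_def)
    qed
    moreover have "(\<Sum>u\<in>B. 1 / (x - u)\<^sup>2) \<le> \<eta>"
    proof (rule R[OF \<open>finite B\<close>])
      show "R \<le> x - u" if "u \<in> B" for u using far_F[of u] that by (simp add: B_def)
      show "\<delta> \<le> \<bar>(x - u) - (x - v)\<bar>" if "u \<in> B" "v \<in> B" "u \<noteq> v" for u v
        using sep_F[of v u] that by (simp add: B_def)
    qed
    ultimately have sum_le: "(\<Sum>u\<in>F. 1 / (x - u)\<^sup>2) \<le> 2 * \<eta>"
      unfolding AB(1) using AB by (simp add: sum.union_disjoint power2_commute[of x])
    have "(\<Sum>u\<in>F. (?c x u)\<^sup>2) \<le> (\<Sum>u\<in>F. C\<^sup>2 * (1 / (x - u)\<^sup>2))"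
    proof (rule sum_mono)
      fix u assume "u \<in> F"
      then have "x \<noteq> u" using far_F[of u] \<open>R > 0\<close> by auto
      then have "(?c x u)\<^sup>2 \<le> (C / \<bar>x - u\<bar>)\<^sup>2" by (intro power_mono decay) auto
      then show "(?c x u)\<^sup>2 \<le> C\<^sup>2 * (1 / (x - u)\<^sup>2)" by (simp add: power_divide)
    qed
    also have "\<dots> \<le> C\<^sup>2 * (2 * \<eta>)"
      unfolding sum_distrib_left[symmetric] by (intro mult_left_mono sum_le) auto
    also have "\<dots> \<le> 1 / 2"
      using \<open>C\<^sup>2 + 1 > 0\<close> by (simp add: \<eta>_def field_simps)
    finally show False using F(3) by simp
  qed
  show thesis
  proof (rule that[of "2 * R"])
    show "2 * R > 0" using \<open>R > 0\<close> by simp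
    fix x
    obtain u where "u \<in> \<Lambda>" "\<bar>u - (x + R)\<bar> < R" using ex by blast
    then show "\<exists>u\<in>\<Lambda>. x \<le> u \<and> u < x + 2 * R" by (intro bexI[of _ u]) auto
  qed
qed

section \<open>Recurrence of spanning patterns\<close>

text \<open>
  The shift comes from a pattern of points that occurs twice, which local finiteness of the difference
  set forces. The spans agree because both occurrences are taken of full rank inside one long window,
  and that window is chosen so that its rank is as small as possible.
\<close>

lemma (in vector_space) exists_shifted_subset_same_span:
  fixes \<phi> :: "real \<Rightarrow> 'b" and \<Lambda> :: "real set"
  assumes fin: "finite B" "range \<phi> \<subseteq> span B" and nz: "\<And>x. \<phi> x \<noteq> 0"
    and "L > 0" and dense: "\<And>x. \<exists>u\<in>\<Lambda>. x \<le> u \<and> u < x + L"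
    and locally_finite: "\<And>R. finite {u - v | u v. u \<in> \<Lambda> \<and> v \<in> \<Lambda> \<and> \<bar>u - v\<bar> \<le> R}"
  obtains I d where "I \<noteq> {}" "I \<subseteq> \<Lambda>" "d > 0" "(\<lambda>u. u + d) ` I \<subseteq> \<Lambda>"
    "span (\<phi> ` I) = span (\<phi> ` (\<lambda>u. u + d) ` I)"
proof -
  define rich where "rich m R x \<longleftrightarrow>
    (\<exists>I\<subseteq>\<Lambda> \<inter> {x..<x + R}. independent (\<phi> ` I) \<and> card (\<phi> ` I) = m)" for m R x
  define P where "P m \<longleftrightarrow> (\<exists>R>0. \<forall>x. rich m R x)" for m
  have bound: "m \<le> card B" if Pm: "P m" for m
  proof -
    from Pm obtain R where "rich m R 0" by (auto simp: P_def)
    then obtain I where "independent (\<phi> ` I)" "card (\<phi> ` I) = m" by (auto simp: rich_def)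
    moreover have "\<phi> ` I \<subseteq> span B" using fin(2) by auto
    ultimately show ?thesis using independent_span_bound[OF fin(1)] by metis
  qed
  have "P 1"
    unfolding P_def
  proof (intro exI[of _ L] conjI allI)
    fix x
    obtain u where u: "u \<in> \<Lambda>" "x \<le> u" "u < x + L" using dense by blast
    then show "rich 1 L x"
      unfolding rich_def using nz by (intro exI[of _ "{u}"]) (auto simp: independent_insert)
  qed (rule \<open>L > 0\<close>)
  define m where "m = (GREATEST m. P m)"
  have "P m" unfolding m_def by (rule GreatestI_nat[where P = P, OF \<open>P 1\<close> bound])
  have "m \<ge> 1" unfolding m_def by (rule Greatest_le_nat[where P = P, OF \<open>P 1\<close> bound])
  have "\<not> P (Suc m)"
    using Greatest_le_nat[of P "Suc m" "card B"] bound unfolding m_def by fastforce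
  obtain R where R: "R > 0" "\<And>x. rich m R x" using \<open>P m\<close> by (auto simp: P_def)
  define G where "G = {u - v | u v. u \<in> \<Lambda> \<and> v \<in> \<Lambda> \<and> \<bar>u - v\<bar> \<le> R}"
  have "finite (Pow G)" using locally_finite by (simp add: G_def)
  define N where "N = card (Pow G)"
  obtain x where x: "\<not> rich (Suc m) (real (Suc N) * R) x"
    using \<open>\<not> P (Suc m)\<close> R(1) unfolding P_def
    by (meson mult_pos_pos of_nat_0_less_iff zero_less_Suc)
  \<comment> \<open>The long window \<open>W\<close> is cut into \<open>Suc N\<close> windows of length \<open>R\<close>, one more than there are patterns.\<close>
  define W where "W = \<Lambda> \<inter> {x..<x + real (Suc N) * R}"
  have "\<forall>k. \<exists>I\<subseteq>\<Lambda> \<inter> {x + real k * R..<x + real k * R + R}.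
      independent (\<phi> ` I) \<and> card (\<phi> ` I) = m"
    using R(2) by (simp add: rich_def)
  then obtain I where I: "\<And>k. I k \<subseteq> \<Lambda> \<inter> {x + real k * R..<x + real k * R + R}"
    "\<And>k. independent (\<phi> ` I k)" "\<And>k. card (\<phi> ` I k) = m"
    by metis
  have window: "u \<in> \<Lambda>" "x + real k * R \<le> u" "u < x + real k * R + R" if "u \<in> I k" for u k
    using I(1)[of k] that by auto
  have ne: "I k \<noteq> {}" for k using I(3)[of k] \<open>m \<ge> 1\<close> by auto
  define i where "i k = (SOME u. u \<in> I k)" for k
  have i: "i k \<in> I k" for k unfolding i_def using ne by (simp add: some_in_eq)
  have IW: "I k \<subseteq> W" if "k \<le> N" for k
  proof -
    have "0 \<le> real k * R" "real k * R + R \<le> real (Suc N) * R"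
      using that R(1) by (simp_all add: algebra_simps)
    then have "{x + real k * R..<x + real k * R + R} \<subseteq> {x..<x + real (Suc N) * R}"
      by (intro ivl_subset[THEN iffD2] disjI2) linarith
    then show ?thesis using I(1)[of k] unfolding W_def by blast
  qed
  \<comment> \<open>A vector outside the span would be a further independent one, which the choice of \<open>x\<close> excludes.\<close>
  have W_span: "\<phi> ` W \<subseteq> span (\<phi> ` I k)" if "k \<le> N" for k
  proof (rule ccontr)
    assume "\<not> \<phi> ` W \<subseteq> span (\<phi> ` I k)"
    then obtain w where w: "w \<in> W" "\<phi> w \<notin> span (\<phi> ` I k)" by auto
    have sub: "insert w (I k) \<subseteq> \<Lambda> \<inter> {x..<x + real (Suc N) * R}"
      using w(1) IW[OF that] by (simp add: W_def)
    have indep: "independent (\<phi> ` insert w (I k))"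
      using w(2) I(2) by (simp add: independent_insertI)
    have "finite (\<phi> ` I k)" using I(3)[of k] \<open>m \<ge> 1\<close> by (intro card_ge_0_finite) simp
    moreover have "\<phi> w \<notin> \<phi> ` I k" using w(2) span_base by blast
    ultimately have "card (\<phi> ` insert w (I k)) = Suc m"
      using I(3)[of k] by simp
    then have "rich (Suc m) (real (Suc N) * R) x" using sub indep unfolding rich_def by blast
    then show False using x by simp
  qed
  have same_span: "span (\<phi> ` I k) = span (\<phi> ` I l)" if "k \<le> N" "l \<le> N" for k l
    unfolding span_eq using W_span IW that by blast
  \<comment> \<open>\<open>p k\<close> is the pattern of \<open>I k\<close>, normalised so that the chosen point \<open>i k\<close> moves to \<open>0\<close>.\<close>
  define p where "p k = (\<lambda>u. u - i k) ` I k" for k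
  have "p ` {..N} \<subseteq> Pow G"
  proof (intro image_subsetI PowI)
    fix k show "p k \<subseteq> G"
    proof
      fix g assume "g \<in> p k"
      then obtain u where u: "u \<in> I k" "g = u - i k" by (auto simp: p_def)
      have "u \<in> \<Lambda>" "i k \<in> \<Lambda>" "\<bar>u - i k\<bar> \<le> R"
        using window[OF u(1)] window[OF i[of k]] by auto
      then show "g \<in> G" unfolding G_def u(2) by blast
    qed
  qed
  then have "card (p ` {..N}) < card {..N}"
    using card_mono[OF \<open>finite (Pow G)\<close>] unfolding N_def by (simp add: less_Suc_eq_le)
  then have "\<not> inj_on p {..N}" by (rule pigeonhole)
  then obtain k l where kl: "k \<le> N" "l \<le> N" "k < l" "p k = p l"
    unfolding inj_on_def by (metis atMost_iff nat_neq_iff)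
  define d where "d = i l - i k"
  have "real k * R + R \<le> real l * R"
    using kl(3) R(1) mult_right_mono[of "real k + 1" "real l" R] by (simp add: algebra_simps)
  then have "d > 0"
    using window[OF i[of k]] window[OF i[of l]] unfolding d_def by linarith
  have "(\<lambda>u. u + d) ` I k = (\<lambda>u. u + i l) ` p k"
    unfolding p_def d_def image_image by (simp add: algebra_simps)
  also have "\<dots> = I l"
    unfolding kl(4) unfolding p_def image_image by simp
  finally have shift: "(\<lambda>u. u + d) ` I k = I l" .
  show thesis
    using that[of "I k" d] ne shift \<open>d > 0\<close> window(1) same_span[OF kl(1,2)] by auto
qed

text \<open>
  \<open>T d\<close> carries the vectors of \<open>I\<close> to those of the translate of \<open>I\<close> by \<open>d\<close>, and \<open>T (- d)\<close> carries them
  back. If both families span \<open>V\<close>, then \<open>T d\<close> and \<open>T (- d)\<close> map \<open>V\<close> onto itself, and the orbit of a point of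
  \<open>I\<close> never leaves \<open>V\<close>.
\<close>

lemma (in vector_space) exists_progression_in_span:
  fixes \<phi> :: "real \<Rightarrow> 'b" and \<Lambda> :: "real set" and T :: "real \<Rightarrow> 'b \<Rightarrow> 'b"
  assumes fin: "finite B" "range \<phi> \<subseteq> span B" and nz: "\<And>x. \<phi> x \<noteq> 0"
    and T: "\<And>d. module_hom scale scale (T d)" "\<And>d x. T d (\<phi> x) = \<phi> (x + d)"
    and "L > 0" and dense: "\<And>x. \<exists>u\<in>\<Lambda>. x \<le> u \<and> u < x + L"
    and locally_finite: "\<And>R. finite {u - v | u v. u \<in> \<Lambda> \<and> v \<in> \<Lambda> \<and> \<bar>u - v\<bar> \<le> R}"
  obtains c d where "d > 0" "\<And>k :: int. \<phi> (c + d * of_int k) \<in> span (\<phi> ` \<Lambda>)"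
proof -
  obtain I d where I: "I \<noteq> {}" "I \<subseteq> \<Lambda>" "d > 0" "(\<lambda>u. u + d) ` I \<subseteq> \<Lambda>"
    and same: "span (\<phi> ` I) = span (\<phi> ` (\<lambda>u. u + d) ` I)"
    by (rule exists_shifted_subset_same_span[OF fin nz \<open>L > 0\<close> dense locally_finite])
  define V where "V = span (\<phi> ` I)"
  have "T d ` V = span (T d ` \<phi> ` I)"
    unfolding V_def by (rule module_hom.span_image[OF T(1), symmetric])
  also have "T d ` \<phi> ` I = \<phi> ` (\<lambda>u. u + d) ` I"
    by (simp add: image_image T(2))
  finally have fwd: "T d ` V = V" using same by (simp add: V_def)
  have "T (- d) ` V = span (T (- d) ` \<phi> ` (\<lambda>u. u + d) ` I)"
    unfolding V_def same by (rule module_hom.span_image[OF T(1), symmetric])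
  also have "T (- d) ` \<phi> ` (\<lambda>u. u + d) ` I = \<phi> ` I"
    by (simp add: image_image T(2))
  finally have bwd: "T (- d) ` V = V" by (simp add: V_def)
  obtain c where "c \<in> I" using I(1) by auto
  have "\<phi> (c + d * of_int k) \<in> V" for k
  proof (induction k rule: int_induct[where k = 0])
    case base
    show ?case using \<open>c \<in> I\<close> by (simp add: V_def span_base)
  next
    case (step1 i)
    then have "T d (\<phi> (c + d * of_int i)) \<in> V" using fwd by auto
    then show ?case by (simp add: T(2) algebra_simps)
  next
    case (step2 i)
    then have "T (- d) (\<phi> (c + d * of_int i)) \<in> V" using bwd by auto
    then show ?case by (simp add: T(2) algebra_simps)
  qed
  moreover have "V \<subseteq> span (\<phi> ` \<Lambda>)" unfolding V_def by (intro span_mono image_mono I(2))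
  ultimately show thesis using that[of d c] I(3) by blast
qed

section \<open>Progressions from an orthogonality relation\<close>

text \<open>
  The sum in \<open>orth\<close> and \<open>maximal\<close> is the value at \<open>\<phi> x\<close> and \<open>\<phi> u\<close> of the sesquilinear form with weights
  \<open>w\<close>. For a fixed \<open>u\<close> in \<open>\<Lambda>\<close> it vanishes on \<open>\<phi> ` \<Lambda>\<close>, hence on its span, so that \<open>maximal\<close> puts every
  \<open>x\<close> with \<open>\<phi> x\<close> in that span into \<open>\<Lambda>\<close>.
\<close>

lemma exists_progression_of_orthogonality:
  fixes \<Lambda> :: "real set" and t :: "'k \<Rightarrow> real" and w :: "'k \<Rightarrow> complex"
  assumes J: "finite J" "J \<noteq> {}"
    and "L > 0" and dense: "\<And>x. \<exists>u\<in>\<Lambda>. x \<le> u \<and> u < x + L"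
    and locally_finite: "\<And>R. finite {u - v | u v. u \<in> \<Lambda> \<and> v \<in> \<Lambda> \<and> \<bar>u - v\<bar> \<le> R}"
    and orth: "\<And>u v. u \<in> \<Lambda> \<Longrightarrow> v \<in> \<Lambda> \<Longrightarrow> (\<Sum>k\<in>J. w k * cis (2 * pi * t k * (u - v))) = 0"
    and maximal: "\<And>x. (\<And>u. u \<in> \<Lambda> \<Longrightarrow> (\<Sum>k\<in>J. w k * cis (2 * pi * t k * (x - u))) = 0) \<Longrightarrow> x \<in> \<Lambda>"
  obtains c d where "d > 0" "\<And>k :: int. c + d * of_int k \<in> \<Lambda>"
proof -
  interpret V: vector_space "\<lambda>(c::complex) (f::'k \<Rightarrow> complex). (\<lambda>k. c * f k)"
    by unfold_locales (auto simp: fun_eq_iff algebra_simps)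
  \<comment> \<open>Setting the coordinates outside \<open>J\<close> to \<open>0\<close> keeps \<open>\<phi>\<close> in the span of finitely many unit vectors \<open>\<epsilon> j\<close>.\<close>
  define \<phi> where "\<phi> x = (\<lambda>k. if k \<in> J then cis (2 * pi * t k * x) else 0)" for x
  define T where "T d f = (\<lambda>k. cis (2 * pi * t k * d) * f k)" for d and f :: "'k \<Rightarrow> complex"
  define \<epsilon> where "\<epsilon> j = (\<lambda>k. if k = j then 1 else 0 :: complex)" for j :: 'k
  have "f \<in> V.span (\<epsilon> ` J)" if "\<And>k. k \<notin> J \<Longrightarrow> f k = 0" for f
  proof -
    have "(\<Sum>j\<in>J. (\<lambda>k. f j * \<epsilon> j k)) \<in> V.span (\<epsilon> ` J)"
      by (intro V.span_sum V.span_scale V.span_base) auto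
    moreover have "(\<Sum>j\<in>A. (\<lambda>k. f j * \<epsilon> j k)) k = (\<Sum>j\<in>A. f j * \<epsilon> j k)" if "finite A" for A k
      using that by (induction A rule: finite_induct) auto
    moreover have "(\<Sum>j\<in>J. f j * \<epsilon> j k) = (\<Sum>j\<in>J. if j = k then f j else 0)" for k
      by (rule sum.cong) (auto simp: \<epsilon>_def)
    ultimately have "(\<Sum>j\<in>J. (\<lambda>k. f j * \<epsilon> j k)) \<in> V.span (\<epsilon> ` J)"
      "(\<Sum>j\<in>J. (\<lambda>k. f j * \<epsilon> j k)) = f"
      using J that by (auto simp: fun_eq_iff)
    then show ?thesis by simp
  qed
  then have range: "range \<phi> \<subseteq> V.span (\<epsilon> ` J)" by (auto simp: \<phi>_def)
  have nz: "\<phi> x \<noteq> 0" for x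
    using J(2) by (auto simp: \<phi>_def fun_eq_iff)
  have T_hom: "module_hom (\<lambda>c f k. c * f k) (\<lambda>c f k. c * f k) (T d)" for d
    by unfold_locales (auto simp: T_def fun_eq_iff algebra_simps)
  have T_shift: "T d (\<phi> x) = \<phi> (x + d)" for d x
    by (auto simp: T_def \<phi>_def fun_eq_iff cis_mult algebra_simps)
  obtain c d where d: "d > 0" and in_span: "\<And>k :: int. \<phi> (c + d * of_int k) \<in> V.span (\<phi> ` \<Lambda>)"
  proof (rule V.exists_progression_in_span
      [OF finite_imageI[OF J(1)] range nz T_hom T_shift \<open>L > 0\<close> dense locally_finite])
    fix c d :: real assume "d > 0" "\<And>k :: int. \<phi> (c + d * of_int k) \<in> V.span (\<phi> ` \<Lambda>)"
    then show thesis by (rule that)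
  qed
  have form: "(\<Sum>k\<in>J. w k * \<phi> x k * cnj (\<phi> u k)) = (\<Sum>k\<in>J. w k * cis (2 * pi * t k * (x - u)))" for x u
    by (rule sum.cong) (auto simp: \<phi>_def cis_cnj cis_mult mult.assoc algebra_simps)
  have "c + d * of_int k \<in> \<Lambda>" for k :: int
  proof (rule maximal)
    fix u assume "u \<in> \<Lambda>"
    have "(\<Sum>k\<in>J. w k * f k * cnj (\<phi> u k)) = 0" if "f \<in> V.span (\<phi> ` \<Lambda>)" for f
      using that
    proof (induction rule: V.span_induct)
      case base
      have "(\<Sum>k\<in>J. w k * (b * f k) * cnj (\<phi> u k)) = b * (\<Sum>k\<in>J. w k * f k * cnj (\<phi> u k))" for b f
        by (simp add: sum_distrib_left mult_ac)
      then show ?case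
        by (intro V.subspaceI) (simp_all add: distrib_left distrib_right sum.distrib)
    next
      case (step f)
      then show ?case using form orth \<open>u \<in> \<Lambda>\<close> by auto
    qed
    from this[OF in_span[of k]] show "(\<Sum>j\<in>J. w j * cis (2 * pi * t j * (c + d * of_int k - u))) = 0"
      by (simp add: form)
  qed
  then show thesis using that d by blast
qed

text \<open>
  Rounding \<open>u\<close> down to the nearest member \<open>v\<close> of the progression leaves a difference \<open>u - v\<close> of size at
  most \<open>d\<close>. There are finitely many such differences, because \<open>u\<close> and \<open>v\<close> both belong to \<open>\<Lambda>\<close>.
\<close>

lemma subset_lattice_with_base:
  fixes \<Lambda> :: "real set"
  assumes "d > 0" and prog: "\<And>k :: int. c + d * of_int k \<in> \<Lambda>"
    and locally_finite: "\<And>R. finite {u - v | u v. u \<in> \<Lambda> \<and> v \<in> \<Lambda> \<and> \<bar>u - v\<bar> \<le> R}"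
  shows "\<exists>L. is_lattice_with_base L \<and> \<Lambda> \<subseteq> L"
proof -
  define B where "B = (\<lambda>g. c + g) ` {u - v | u v. u \<in> \<Lambda> \<and> v \<in> \<Lambda> \<and> \<bar>u - v\<bar> \<le> d}"
  define L where "L = {b + d * of_int k | b k. b \<in> insert 0 B}"
  have "finite B" unfolding B_def by (intro finite_imageI locally_finite)
  then have "is_lattice_with_base L"
    using \<open>d > 0\<close> unfolding is_lattice_with_base_def L_def by blast
  moreover have "u \<in> L" if "u \<in> \<Lambda>" for u
  proof -
    define k where "k = \<lfloor>(u - c) / d\<rfloor>"
    define v where "v = c + d * of_int k"
    have "of_int k \<le> (u - c) / d" "(u - c) / d < of_int k + 1"
      unfolding k_def by linarith+
    then have "\<bar>u - v\<bar> \<le> d"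
      using \<open>d > 0\<close> unfolding v_def by (simp add: field_simps)
    then have "c + (u - v) \<in> B"
      using that prog[of k] unfolding B_def v_def by blast
    moreover have "u = c + (u - v) + d * of_int k" by (simp add: v_def)
    ultimately show ?thesis unfolding L_def by blast
  qed
  ultimately show ?thesis by blast
qed

section \<open>Spectra with separated differences\<close>

theorem lemma4p4:
  fixes n :: nat and a r :: "nat \<Rightarrow> real" and \<Omega> \<Lambda> \<Gamma> :: "real set" and \<delta> :: real
  assumes "n \<ge> 1"
    and "\<Omega> = (\<Union>j\<in>{1..n}. {a j ..< a j + r j})"
    and "\<And>j. 1 \<le> j \<Longrightarrow> j \<le> n \<Longrightarrow> r j > 0"
    and "(\<Sum>j=1..n. r j) = 1"
    and "\<And>j. 1 \<le> j \<Longrightarrow> j < n \<Longrightarrow> a j + r j < a (j + 1)"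
    and "is_spectrum \<Omega> \<Lambda>"
    and "0 \<in> \<Lambda>"
    and "\<Gamma> = {x - y | x y. x \<in> \<Lambda> \<and> y \<in> \<Lambda>}"
    and "\<delta> > 0"
    and "separated_set \<delta> \<Gamma>"
  shows "(\<exists>c d :: real. d > 0 \<and> {c + d * of_int k | k :: int. True} \<subseteq> \<Lambda>)
    \<and> (\<exists>L. is_lattice_with_base L \<and> \<Lambda> \<subseteq> L)"
proof -
  note \<Omega> = \<open>\<Omega> = (\<Union>j\<in>{1..n}. {a j ..< a j + r j})\<close>
  note spec = \<open>is_spectrum \<Omega> \<Lambda>\<close>
  note \<Gamma> = \<open>\<Gamma> = {x - y | x y. x \<in> \<Lambda> \<and> y \<in> \<Lambda>}\<close>
  note sep = separated_setD[OF \<open>separated_set \<delta> \<Gamma>\<close>]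
  define \<mu> where "\<mu> = measure lebesgue \<Omega>"
  have "\<mu> > 0" using spec by (simp add: is_spectrum_def \<mu>_def)
  have le: "a j \<le> a j + r j" if "j \<in> {1..n}" for j
    using assms(3)[of j] that by simp
  have disj: "disjoint_family_on (\<lambda>j. {a j..<a j + r j}) {1..n}"
    by (rule ordered_intervals_disjoint) (use assms(3,5) in auto)
  have locally_finite: "finite {u - v | u v. u \<in> \<Lambda> \<and> v \<in> \<Lambda> \<and> \<bar>u - v\<bar> \<le> R}" (is "finite ?D") for R
  proof (rule finite_separated_bounded[OF \<open>\<delta> > 0\<close>, where R = R])
    have "?D \<subseteq> \<Gamma>" unfolding \<Gamma> by blast
    then show "\<delta> \<le> \<bar>x - y\<bar>" if "x \<in> ?D" "y \<in> ?D" "x \<noteq> y" for x y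
      using sep that by blast
  qed auto
  have "\<Lambda> \<subseteq> \<Gamma>" using \<open>0 \<in> \<Lambda>\<close> unfolding \<Gamma> by force
  then have sep_\<Lambda>: "\<delta> \<le> \<bar>u - v\<bar>" if "u \<in> \<Lambda>" "v \<in> \<Lambda>" "u \<noteq> v" for u v
    using sep that by blast
  obtain L where L: "L > 0" "\<And>x. \<exists>u\<in>\<Lambda>. x \<le> u \<and> u < x + L"
  proof (rule spectrum_relatively_dense[OF spec \<open>\<delta> > 0\<close> sep_\<Lambda>])
    show "cmod (L2_inner (lebesgue_on \<Omega>) (exponential_on \<Omega> x) (exponential_on \<Omega> y))
        \<le> (real (card {1..n}) / (pi * measure lebesgue \<Omega>)) / \<bar>x - y\<bar>" if "x \<noteq> y" for x y
      by (rule norm_L2_inner_exponential_on_le[OF _ le disj \<Omega> that])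
        (use \<open>\<mu> > 0\<close> in \<open>auto simp: \<mu>_def\<close>)
  next
    fix L assume "L > 0" "\<And>x. \<exists>u\<in>\<Lambda>. x \<le> u \<and> u < x + L"
    then show thesis by (rule that)
  qed
  define J where "J = (UNIV :: bool set) \<times> {1..n}"
  define t where "t = (\<lambda>(b, j). if b then a j + r j else a j)"
  define w where "w = (\<lambda>(b, j :: nat). if b then 1 else - 1 :: complex)"
  have weighted: "(\<Sum>k\<in>J. w k * cis (2 * pi * t k * s))
      = (\<Sum>j\<in>{1..n}. exp (2 * of_real pi * \<i> * of_real (s * (a j + r j)))
          - exp (2 * of_real pi * \<i> * of_real (s * a j)))" for s
  proof -
    have "(\<Sum>k\<in>J. w k * cis (2 * pi * t k * s))
        = (\<Sum>b\<in>UNIV. \<Sum>j\<in>{1..n}. w (b, j) * cis (2 * pi * t (b, j) * s))"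
      unfolding J_def by (simp add: sum.cartesian_product)
    also have "\<dots> = (\<Sum>j\<in>{1..n}. cis (2 * pi * (a j + r j) * s) - cis (2 * pi * a j * s))"
      by (simp add: UNIV_bool w_def t_def sum_subtractf sum_negf)
    finally show ?thesis by (simp add: cis_conv_exp algebra_simps)
  qed
  have inner: "L2_inner (lebesgue_on \<Omega>) (exponential_on \<Omega> x) (exponential_on \<Omega> y) = 0
      \<longleftrightarrow> (\<Sum>k\<in>J. w k * cis (2 * pi * t k * (x - y))) = 0" if "x \<noteq> y" for x y
  proof -
    have "2 * of_real (pi * measure lebesgue \<Omega>) * \<i> * of_real (x - y) \<noteq> (0 :: complex)"
      using \<open>\<mu> > 0\<close> that by (simp add: \<mu>_def)
    moreover have "L2_inner (lebesgue_on \<Omega>) (exponential_on \<Omega> x) (exponential_on \<Omega> y)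
        = (\<Sum>k\<in>J. w k * cis (2 * pi * t k * (x - y)))
          / (2 * of_real (pi * measure lebesgue \<Omega>) * \<i> * of_real (x - y))"
      unfolding weighted by (rule L2_inner_exponential_on[OF _ le disj \<Omega> that]) auto
    ultimately show ?thesis by (simp only: divide_eq_0_iff simp_thms)
  qed
  have diag: "(\<Sum>k\<in>J. w k * cis (2 * pi * t k * (x - x))) = 0" for x
    unfolding weighted by simp
  obtain c d where "d > 0" and prog: "\<And>k :: int. c + d * of_int k \<in> \<Lambda>"
  proof (rule exists_progression_of_orthogonality[where J = J and w = w and t = t and \<Lambda> = \<Lambda>])
    show "finite J" "J \<noteq> {}" using \<open>n \<ge> 1\<close> by (auto simp: J_def)
    show "(\<Sum>k\<in>J. w k * cis (2 * pi * t k * (u - v))) = 0" if "u \<in> \<Lambda>" "v \<in> \<Lambda>" for u v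
    proof (cases "u = v")
      case False
      then have "L2_inner (lebesgue_on \<Omega>) (exponential_on \<Omega> u) (exponential_on \<Omega> v) = 0"
        using that spec by (simp add: is_spectrum_def L2_orthonormal_basis_def)
      then show ?thesis using inner[OF False] by blast
    qed (use diag in simp)
    show "x \<in> \<Lambda>" if "\<And>u. u \<in> \<Lambda> \<Longrightarrow> (\<Sum>k\<in>J. w k * cis (2 * pi * t k * (x - u))) = 0" for x
    proof (rule spectrum_maximal[OF spec])
      fix u assume "u \<in> \<Lambda>" "u \<noteq> x"
      then show "L2_inner (lebesgue_on \<Omega>) (exponential_on \<Omega> x) (exponential_on \<Omega> u) = 0"
        using inner[of x u] that[of u] by blast
    qed
  next
    fix c d :: real assume "d > 0" "\<And>k :: int. c + d * of_int k \<in> \<Lambda>"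
    then show thesis by (rule that)
  qed (rule L locally_finite)+
  then have "{c + d * of_int k | k :: int. True} \<subseteq> \<Lambda>" by auto
  with \<open>d > 0\<close> subset_lattice_with_base[OF \<open>d > 0\<close> prog locally_finite] show ?thesis by blast
qed

end
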